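(* Let $a,b,c,p_1,q_1,r_1,p_2,q_2,r_2$ be real numbers with $c\neq 0$. Let $(P_n)_{n\in\mathbb{Z}}=\mathcal{P}(x)(p_1,q_1,r_1;a,b,c)$, $(Q_n)_{n\in\mathbb{Z}}=\mathcal{P}(x)(p_2,q_2,r_2;a,b,c)$ and $(U_n)_{n\in\mathbb{Z}}=\mathcal{P}(x)(0,0,1;a,b,c)$. Then for all integers $s,i,j$, \[ P_{s+i} Q_{s+j} - P_{s} Q_{s+i+j} = (-c)^s (P_1 Q_j - P_0 Q_{j+1})\, U_i . \]
   Context: For real numbers $p,q,r,a,b,c$ with $c\neq 0$, $\mathcal{P}(x)(p,q,r;a,b,c)=(P_n)_{n\in\mathbb{Z}}$ denotes the sequence of polynomials in the variable $x$ defined by $P_0=p$, $P_1=qx+r$, $P_{n+2}=(ax+b)P_{n+1}+cP_n$ for $n\ge 0$, and for $n<0$ by $P_n=-\frac{ax+b}{c}P_{n+1}+\frac{1}{c}P_{n+2}$. In particular $(U_n)=\mathcal{P}(x)(0,0,1;a,b,c)$ satisfies $U_0=0$, $U_1=1$ and the same recurrence. *)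

theory Defs
  imports Complex_Main "HOL-Computational_Algebra.Polynomial"
begin

text \<open>
  The sequence \<open>\<P>(x)(p,q,r;a,b,c)\<close>, indexed by all integers. The linear
  polynomials \<open>qx + r\<close> and \<open>ax + b\<close> are \<open>[:r, q:]\<close> and \<open>[:b, a:]\<close>. The last
  branch (\<open>n < 0\<close>) is only meaningful for \<open>c \<noteq> 0\<close>.
\<close>

function poly_seq ::
  "real \<Rightarrow> real \<Rightarrow> real \<Rightarrow> real \<Rightarrow> real \<Rightarrow> real \<Rightarrow> int \<Rightarrow> real poly" where
  "poly_seq p q r a b c n =
    (if n = 0 then [:p:]
     else if n = 1 then [:r, q:]
     else if n \<ge> 2 then
       [:b, a:] * poly_seq p q r a b c (n - 1) + smult c (poly_seq p q r a b c (n - 2))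
     else
       - smult (1 / c) [:b, a:] * poly_seq p q r a b c (n + 1)
       + smult (1 / c) (poly_seq p q r a b c (n + 2)))"
  by pat_completeness auto
termination
  by (relation "measure (\<lambda>(p, q, r, a, b, c, n). nat (if n < 0 then 2 - n else n))") auto

declare poly_seq.simps [simp del]

lemma poly_seq_0: "poly_seq p q r a b c 0 = [:p:]"
  by (simp add: poly_seq.simps)

lemma poly_seq_1: "poly_seq p q r a b c 1 = [:r, q:]"
  by (simp add: poly_seq.simps)

lemma poly_seq_nonneg:
  assumes "n \<ge> 0"
  shows "poly_seq p q r a b c (n + 2) =
    [:b, a:] * poly_seq p q r a b c (n + 1) + smult c (poly_seq p q r a b c n)"
  using assms by (subst poly_seq.simps) (simp add: add.commute)

lemma poly_seq_neg:
  assumes "n < 0"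
  shows "poly_seq p q r a b c n =
    - smult (1 / c) [:b, a:] * poly_seq p q r a b c (n + 1)
    + smult (1 / c) (poly_seq p q r a b c (n + 2))"
  using assms by (subst poly_seq.simps) simp

end

theory Submission imports Defs begin

text \<open>
  For fixed \<open>s\<close> and \<open>j\<close>, the left-hand side satisfies the recurrence as a function of \<open>i\<close> and
  vanishes at \<open>i = 0\<close>, so it is \<open>U\<^sub>i\<close> times its value at \<open>i = 1\<close>. That value is the
  Casoratian of \<open>n \<mapsto> P\<^sub>n\<close> and \<open>n \<mapsto> Q\<^bsub>n+j\<^esub>\<close>, which is multiplied by \<open>- c\<close> when \<open>s\<close>
  increases by \<open>1\<close>.
\<close>

text \<open>The recurrence is required at every integer, negative ones included, which makes it
  stable under shifts of the index.\<close>

definition satisfies_rec :: "'a::field poly \<Rightarrow> 'a \<Rightarrow> (int \<Rightarrow> 'a poly) \<Rightarrow> bool" where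
  "satisfies_rec A c f \<longleftrightarrow> (\<forall>n. f (n + 2) = A * f (n + 1) + smult c (f n))"

lemma satisfies_recD:
  "satisfies_rec A c f \<Longrightarrow> f (n + 2) = A * f (n + 1) + smult c (f n)"
  by (simp add: satisfies_rec_def)

text \<open>For negative \<open>n\<close> the defining equation is the same recurrence solved for
  the lowest term; multiplying by \<open>c\<close> recovers it.\<close>

lemma satisfies_rec_poly_seq:
  assumes "c \<noteq> 0"
  shows "satisfies_rec [:b, a:] c (poly_seq p q r a b c)"
  unfolding satisfies_rec_def
proof
  fix n :: int
  show "poly_seq p q r a b c (n + 2) =
    [:b, a:] * poly_seq p q r a b c (n + 1) + smult c (poly_seq p q r a b c n)"
  proof (cases "n \<ge> 0")
    case True
    then show ?thesis by (rule poly_seq_nonneg)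
  next
    case False
    then have "smult c (poly_seq p q r a b c n) =
      - ([:b, a:] * poly_seq p q r a b c (n + 1)) + poly_seq p q r a b c (n + 2)"
      using assms
      by (simp only: poly_seq_neg[of n] not_le smult_add_right smult_minus_right smult_smult
          mult_smult_left mult_minus_left) simp
    then show ?thesis by simp
  qed
qed

lemma satisfies_rec_shift:
  assumes "satisfies_rec A c f"
  shows "satisfies_rec A c (\<lambda>n. f (m + n))"
  using satisfies_recD[OF assms, of "m + _"] by (simp add: satisfies_rec_def add.assoc)

lemma satisfies_rec_mult:
  assumes "satisfies_rec A c f"
  shows "satisfies_rec A c (\<lambda>n. g * f n)"
  using satisfies_recD[OF assms] by (simp add: satisfies_rec_def algebra_simps)

lemma satisfies_rec_diff:
  assumes "satisfies_rec A c f" and "satisfies_rec A c g"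
  shows "satisfies_rec A c (\<lambda>n. f n - g n)"
  using satisfies_recD[OF assms(1)] satisfies_recD[OF assms(2)]
  by (simp add: satisfies_rec_def algebra_simps smult_diff_right)

lemma satisfies_rec_eq_0:
  assumes rec: "satisfies_rec A c f" and "c \<noteq> 0" and "f 0 = 0" and "f 1 = 0"
  shows "f n = 0"
proof -
  \<comment> \<open>The recurrence has order two, so the induction carries two consecutive zeros;
    its downward step cancels \<open>c\<close>.\<close>
  have "f n = 0 \<and> f (n + 1) = 0"
  proof (induction n rule: int_induct[where k = 0])
    case base
    then show ?case using assms by simp
  next
    case (step1 n)
    then show ?case using satisfies_recD[OF rec, of n] by (simp add: add.assoc)
  next
    case (step2 n)
    then show ?case using satisfies_recD[OF rec, of "n - 1"] \<open>c \<noteq> 0\<close> by (simp add: add.commute)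
  qed
  then show ?thesis ..
qed

text \<open>Expanding \<open>f (n + 2)\<close> and \<open>g (n + 2)\<close> in the Casoratian at
  \<open>n + 1\<close>, the terms with \<open>A\<close> cancel and \<open>- c\<close> times the
  Casoratian at \<open>n\<close> remains.\<close>

lemma casoratian:
  assumes "satisfies_rec A c f" and "satisfies_rec A c g" and "c \<noteq> 0"
  shows "f (n + 1) * g n - f n * g (n + 1) =
    smult ((- c) powi n) (f 1 * g 0 - f 0 * g 1)"
proof -
  define W where "W n = f (n + 1) * g n - f n * g (n + 1)" for n
  have step: "W (n + 1) = smult (- c) (W n)" for n
    using satisfies_recD[OF assms(1), of n] satisfies_recD[OF assms(2), of n]
    by (simp add: W_def algebra_simps smult_diff_right)
  have "W n = smult ((- c) powi n) (W 0)"
  proof (induction n rule: int_induct[where k = 0])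
    case base
    then show ?case by simp
  next
    case (step1 n)
    then show ?case using \<open>c \<noteq> 0\<close> by (simp add: step power_int_add mult.commute)
  next
    case (step2 n)
    have "W (n - 1) = smult (inverse (- c)) (W n)"
      using step[of "n - 1"] \<open>c \<noteq> 0\<close> by simp
    then show ?case using step2 \<open>c \<noteq> 0\<close> by (simp add: power_int_diff field_simps)
  qed
  then show ?thesis by (simp add: W_def)
qed

theorem theorem1:
  fixes a b c p1 q1 r1 p2 q2 r2 :: real
    and P Q U :: "int \<Rightarrow> real poly"
    and s i j :: int
  assumes "c \<noteq> 0"
    and "P = poly_seq p1 q1 r1 a b c"
    and "Q = poly_seq p2 q2 r2 a b c"
    and "U = poly_seq 0 0 1 a b c"
  shows "P (s + i) * Q (s + j) - P s * Q (s + i + j) =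
    smult ((- c) powi s) ((P 1 * Q j - P 0 * Q (j + 1)) * U i)"
proof -
  have P: "satisfies_rec [:b, a:] c P" and Q: "satisfies_rec [:b, a:] c Q"
    and U: "satisfies_rec [:b, a:] c U"
    using assms by (simp_all add: satisfies_rec_poly_seq)
  have U01: "U 0 = 0" "U 1 = 1"
    using assms(4) by (simp_all add: poly_seq_0 poly_seq_1 one_pCons)
  \<comment> \<open>The value at \<open>i = 1\<close>, with indices written to match
    \<open>casoratian\<close> for \<open>P\<close> and the shift of \<open>Q\<close> by
    \<open>j\<close>.\<close>
  define W where "W = P (s + 1) * Q (j + s) - P s * Q (j + (s + 1))"
  \<comment> \<open>Factors independent of \<open>i\<close> stand on the left, as in
    \<open>satisfies_rec_mult\<close>. Subtracting \<open>W * U i\<close> makes the value at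
    \<open>i = 1\<close> vanish too.\<close>
  have "Q (s + j) * P (s + i) - P s * Q (s + j + i) - W * U i = 0"
  proof (rule satisfies_rec_eq_0[where c = c])
    show "satisfies_rec [:b, a:] c
        (\<lambda>i. Q (s + j) * P (s + i) - P s * Q (s + j + i) - W * U i)"
      by (intro satisfies_rec_diff satisfies_rec_mult satisfies_rec_shift P Q U)
  qed (use assms(1) in \<open>simp_all add: U01 W_def algebra_simps\<close>)
  moreover have "W = smult ((- c) powi s) (P 1 * Q j - P 0 * Q (j + 1))"
    using casoratian[OF P satisfies_rec_shift[OF Q, of j] assms(1), of s] by (simp add: W_def)
  ultimately show ?thesis by (simp add: algebra_simps)
qed

end
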